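(* Let $G=(V,A)$ be a routing graph with conditional fare network $\mathcal N=(\mathcal T,\Gamma,w,e,\mu,\pi)$, let $C=(C_F,C_P,C_N)$ be its comparability partition, let $s,t\in V$ with $P_{s,t}\neq\emptyset$, and let $\pi^*:=\min_{p\in P_{s,t}}\pi(p)$. Then there is at least one $s,t$-path $p^*$ with $\pi^*=\pi(p^* )$ and $p^*\in P^f_{s,t}$, where $P^f_{s,t}$ is the set of $s,t$-paths that are state-optimal with respect to $\leq_C$.
   Context: All directed graphs are finite. A partially ordered positive monoid $(H,+,\leq)$ is a set $H$ with an associative operation $+$ and neutral element $\mathbf 0$, together with a partial order $\leq$ on $H$ such that $h_1\leq h_2\Rightarrow h_1+x\leq h_2+x$ for all $h_1,h_2,x\in H$, and $\mathbf 0\leq h$ for all $h\in H$. Let $G=(V,A)$ be a directed graph (the routing graph). An $s,t$-path is a sequence of vertices $(v_0,\dots,v_n)$ with $v_0=s$, $v_n=t$ and $(v_{i-1},v_i)\in A$ for all $i$; vertices may repeat. $P_{s,t}$ is the set of all $s,t$-paths in $G$. A conditional fare network (CFN) $(\mathcal T,\Gamma,w,e,\mu,\pi)$ of $G$ consists of: (1) a finite directed acyclic graph $\mathcal T=(T,E)$ (the ticket graph; elements of $T$ are tickets) with a ticket transition function $\Gamma:T\times H\times S\to T$, where $(H,+,\leq)$ is a partially ordered positive monoid and $S$ is a set of fare events, such that $\Gamma(\tau,h,s)\in\delta^+(\tau)\cup\{\tau\}$ for all $\tau\in T,h\in H,s\in S$ ($\delta^+(\tau)$ is the set of out-neighbours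 of $\tau$ in $\mathcal T$); (2) arc weights $w:A\to H$; (3) arc events $e:A\to S$; (4) initial fare states $\mu:V\to F$, where $F:=T\times H$ is the set of fare states; (5) a price function $\pi:T\to\mathbb Q_{\geq 0}$ that is non-decreasing along directed paths of $\mathcal T$, i.e. if there is a directed $\tau_1,\tau_2$-path in $\mathcal T$ then $\pi(\tau_1)\leq\pi(\tau_2)$. For a fare state $f\in F$ write $f=(\tau(f),w(f))$ with $\tau(f)\in T$, $w(f)\in H$. The fare update function $\mathrm{Up}:F\times A\to F$ is given by $g=\mathrm{Up}(f,a)$ with $w(g)=w(f)+w(a)$ and $\tau(g)=\Gamma(\tau(f),w(g),e(a))$. The fare state $f(p)$ of a path $p=(v_0,\dots,v_n)$ is $f_n$, where $f_0=\mu(v_0)$ and $f_i=\mathrm{Up}(f_{i-1},(v_{i-1},v_i))$. The price of a path is $\pi(p):=\pi(\tau(f(p)))$. For tickets write $\tau_1\rightarrow\tau_2$ if there is a directed path from $\tau_1$ to $\tau_2$ in $\mathcal T$ (including the case $\tau_1=\tau_2$). The reach $R(\tau)$ of $\tau\in T$ is the subgraph of $\mathcal T$ induced by $\{k\in T:\tau\rightarrow k\}$. $R(\tau)$ is traceable if it contains a (directed) Hamiltonian path. $R(\tau)$ has the no-overtaking property if for all $k,l\in R(\tau)$ with $k\rightarrow l$ and all $(h,s)\in H\times S$ it holds that $\Gamma(k,h,s)\rightarrow\Gamma(l,\bar h,s)$ for all $\bar h\in H$ with $h\leq\bar h$. The comparability partition $C=(C_F,C_P,C_N)$ of $T$ is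 $C_F:=\{\tau\in T: R(\tau)\text{ is traceable and has the no-overtaking property}\}$, $C_P:=\{\tau\in T\setminus C_F:\ \forall k\in R(\tau)\ \forall s\in S\ \forall h_1,h_2\in H:\ \Gamma(k,h_1,s)=\Gamma(k,h_2,s)\}$, $C_N:=T\setminus(C_F\cup C_P)$. For fare states $f_1=(\tau_1,h_1)$, $f_2=(\tau_2,h_2)$, define $f_1\leq_C f_2$ if and only if $\tau_1\notin C_N$, $h_1\leq h_2$, and: $\tau_1=\tau_2$ if $\tau_1\in C_P$; $\tau_1\rightarrow\tau_2$ if $\tau_1\in C_F$. Write $f_1<_C f_2$ if $f_1\leq_C f_2$ and ($h_1<h_2$ or $\tau_1\neq\tau_2$). An $s,t$-path $p^*$ is state-optimal if there is no $s,t$-path $p$ with $f(p)<_C f(p^* )$; $P^f_{s,t}$ is the set of all state-optimal $s,t$-paths.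
   Formalization: The formal statement additionally assumes h ≤ h + x for all h, x in H (automatic if + is commutative or monotone on both sides); with only right-translation monotonicity the claim fails, since path weights can descend forever. *)

theory Defs
  imports "Graph_Theory.Graph_Theory" Complex_Main
begin

text \<open>Neither commutativity of the addition nor monotonicity of translations on the left
  is part of this definition, so \<open>0 \<le> x\<close> gives \<open>h \<le> x + h\<close> but not \<open>h \<le> h + x\<close>. Where fare
  weights must not decrease when a path is extended, the latter is a separate hypothesis. It
  holds whenever the addition is commutative or left translations are monotone. Without it
  state-optimal paths need not exist: adjoin to the natural numbers (as sums of \<open>b\<close>) elements
  \<open>A 0 > A 1 > A 2 > \<dots>\<close> above all of them, with \<open>A n + b = A (n + 1)\<close> and \<open>x + A m = A m\<close>;
  with an arc of weight \<open>A 0\<close> from \<open>s\<close> to \<open>t\<close>, a loop of weight \<open>b\<close> at \<open>t\<close> and a single ticket,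
  every \<open>s,t\<close>-path is dominated by its extension along the loop.\<close>

class po_positive_monoid = monoid_add + order +
  assumes translate_right_mono: "h1 \<le> h2 \<Longrightarrow> h1 + x \<le> h2 + x"
    and zero_least: "0 \<le> h"

definition st_paths :: "'v pair_pre_digraph \<Rightarrow> 'v \<Rightarrow> 'v \<Rightarrow> 'v list set" where
  "st_paths G s t = {p. vwalk p (with_proj G) \<and> hd p = s \<and> last p = t}"

record ('v, 't, 'h, 's) cfn =
  ticket_graph :: "'t pair_pre_digraph"
  fare_events :: "'s set"
  transition :: "'t \<Rightarrow> 'h \<Rightarrow> 's \<Rightarrow> 't"
  arc_weight :: "'v \<times> 'v \<Rightarrow> 'h"
  arc_event :: "'v \<times> 'v \<Rightarrow> 's"
  initial_state :: "'v \<Rightarrow> 't \<times> 'h"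
  ticket_price :: "'t \<Rightarrow> rat"

abbreviation tickets :: "('v, 't, 'h, 's) cfn \<Rightarrow> 't set" where
  "tickets N \<equiv> pverts (ticket_graph N)"

text \<open>As the library's reachability, this is reflexive exactly on the tickets and includes
  membership of both ends in the ticket set.\<close>

abbreviation ticket_reaches :: "('v, 't, 'h, 's) cfn \<Rightarrow> 't \<Rightarrow> 't \<Rightarrow> bool" where
  "ticket_reaches N \<tau>1 \<tau>2 \<equiv> \<tau>1 \<rightarrow>\<^sup>*\<^bsub>with_proj (ticket_graph N)\<^esub> \<tau>2"

text \<open>The monoid is the whole type \<open>'h\<close>; vertices, tickets and fare events are carrier sets.\<close>

locale conditional_fare_network =
  routing: pair_fin_digraph G + ticket: pair_fin_digraph "ticket_graph N"
  for G :: "'v pair_pre_digraph" and N :: "('v, 't, 'h::po_positive_monoid, 's) cfn" +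
  assumes ticket_graph_acyclic: "acyclic (parcs (ticket_graph N))"
    and transition_step:
      "\<lbrakk>\<tau> \<in> tickets N; s \<in> fare_events N\<rbrakk>
        \<Longrightarrow> transition N \<tau> h s \<in> parcs (ticket_graph N) `` {\<tau>} \<union> {\<tau>}"
    and arc_event_mem: "a \<in> parcs G \<Longrightarrow> arc_event N a \<in> fare_events N"
    and initial_state_mem: "v \<in> pverts G \<Longrightarrow> initial_state N v \<in> tickets N \<times> UNIV"
    and ticket_price_nonneg: "\<tau> \<in> tickets N \<Longrightarrow> 0 \<le> ticket_price N \<tau>"
    and ticket_price_mono:
      "ticket_reaches N \<tau>1 \<tau>2 \<Longrightarrow> ticket_price N \<tau>1 \<le> ticket_price N \<tau>2"

fun fare_update ::
    "('v, 't, 'h::plus, 's) cfn \<Rightarrow> 't \<times> 'h \<Rightarrow> 'v \<times> 'v \<Rightarrow> 't \<times> 'h" where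
  "fare_update N (\<tau>, h) a =
    (transition N \<tau> (h + arc_weight N a) (arc_event N a), h + arc_weight N a)"

definition path_state :: "('v, 't, 'h::plus, 's) cfn \<Rightarrow> 'v list \<Rightarrow> 't \<times> 'h" where
  "path_state N p = foldl (fare_update N) (initial_state N (hd p)) (vwalk_arcs p)"

definition path_price :: "('v, 't, 'h::plus, 's) cfn \<Rightarrow> 'v list \<Rightarrow> rat" where
  "path_price N p = ticket_price N (fst (path_state N p))"

definition reach :: "('v, 't, 'h, 's) cfn \<Rightarrow> 't \<Rightarrow> ('t, 't \<times> 't) pre_digraph" where
  "reach N \<tau> = with_proj (ticket_graph N) \<restriction> {k. ticket_reaches N \<tau> k}"

definition traceable :: "('a, 'b) pre_digraph \<Rightarrow> bool" where
  "traceable D \<longleftrightarrow> (\<exists>p. vpath p D \<and> set p = verts D)"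

definition no_overtaking :: "('v, 't, 'h::ord, 's) cfn \<Rightarrow> 't \<Rightarrow> bool" where
  "no_overtaking N \<tau> \<longleftrightarrow>
    (\<forall>k\<in>verts (reach N \<tau>). \<forall>l\<in>verts (reach N \<tau>). ticket_reaches N k l \<longrightarrow>
      (\<forall>h. \<forall>s\<in>fare_events N. \<forall>h'. h \<le> h' \<longrightarrow>
        ticket_reaches N (transition N k h s) (transition N l h' s)))"

definition C_F :: "('v, 't, 'h::ord, 's) cfn \<Rightarrow> 't set" where
  "C_F N = {\<tau> \<in> tickets N. traceable (reach N \<tau>) \<and> no_overtaking N \<tau>}"

definition C_P :: "('v, 't, 'h::ord, 's) cfn \<Rightarrow> 't set" where
  "C_P N = {\<tau> \<in> tickets N - C_F N.
    \<forall>k\<in>verts (reach N \<tau>). \<forall>s\<in>fare_events N. \<forall>h1 h2. transition N k h1 s = transition N k h2 s}"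

definition C_N :: "('v, 't, 'h::ord, 's) cfn \<Rightarrow> 't set" where
  "C_N N = tickets N - (C_F N \<union> C_P N)"

fun state_le :: "('v, 't, 'h::ord, 's) cfn \<Rightarrow> 't \<times> 'h \<Rightarrow> 't \<times> 'h \<Rightarrow> bool" where
  "state_le N (\<tau>1, h1) (\<tau>2, h2) \<longleftrightarrow>
    \<tau>1 \<notin> C_N N \<and> h1 \<le> h2 \<and>
    (\<tau>1 \<in> C_P N \<longrightarrow> \<tau>1 = \<tau>2) \<and> (\<tau>1 \<in> C_F N \<longrightarrow> ticket_reaches N \<tau>1 \<tau>2)"

definition state_less :: "('v, 't, 'h::ord, 's) cfn \<Rightarrow> 't \<times> 'h \<Rightarrow> 't \<times> 'h \<Rightarrow> bool" where
  "state_less N f1 f2 \<longleftrightarrow> state_le N f1 f2 \<and> (snd f1 < snd f2 \<or> fst f1 \<noteq> fst f2)"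

definition state_optimal_paths ::
    "'v pair_pre_digraph \<Rightarrow> ('v, 't, 'h::{plus, ord}, 's) cfn \<Rightarrow> 'v \<Rightarrow> 'v \<Rightarrow> 'v list set" where
  "state_optimal_paths G N s t =
    {p \<in> st_paths G s t. \<not> (\<exists>q\<in>st_paths G s t. state_less N (path_state N q) (path_state N p))}"

end

theory Submission
  imports Defs
begin

text \<open>If \<open>f1 <\<^sub>C f2\<close> then either the ticket of \<open>f1\<close> lies strictly before that of \<open>f2\<close> in the
  acyclic ticket graph, or the tickets agree and the weight strictly drops. Hence
  \<open>state_less\<close> is contained in a lexicographic product, and it is well-founded on the states of
  the walks starting at \<open>s\<close> as soon as there is no infinite strictly descending sequence of
  weights of such walks. Given this, take a walk whose state is minimal among those of the
  cheapest \<open>s,t\<close>-walks. A walk dominating it ends in an earlier ticket, so it costs no more, is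
  itself cheapest, and contradicts minimality.

  There are in general infinitely many walks, and cycles cannot simply be deleted: in a ticket of
  \<open>C_N\<close>, accumulating weight along a cycle may be what leads to the cheap ticket. The weights
  nevertheless form a well-quasi-order. Deleting arcs from a sequence of arcs can only
  decrease its total weight, because \<open>h \<le> h + x\<close> and translation on the right is monotone, and
  there are only finitely many arcs, so this is an instance of Higman's lemma. The proof below is
  Nash-Williams' argument by a minimal bad sequence, carried out on accumulated values
  instead of subwords: a bad sequence is one in which no term is below a later one.\<close>

section \<open>Higman's lemma for accumulated values\<close>

text \<open>Each term is chosen of least measure among the continuations, by sequences satisfying
  \<open>P\<close>, of the terms chosen before. The resulting diagonal sequence satisfies \<open>P\<close> provided
  \<open>P\<close> is determined by finite prefixes, which is what \<open>closed\<close> says.\<close>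

lemma minimal_sequence_exists:
  fixes P :: "(nat \<Rightarrow> 'x) \<Rightarrow> bool" and size :: "'x \<Rightarrow> nat"
  assumes "P u"
    and closed: "\<And>m. (\<And>n. \<exists>v. P v \<and> (\<forall>i<n. v i = m i)) \<Longrightarrow> P m"
  obtains m where "P m"
    and "\<And>n v. P v \<Longrightarrow> (\<And>i. i < n \<Longrightarrow> v i = m i) \<Longrightarrow> size (m n) \<le> size (v n)"
proof -
  define agree where "agree n v w \<longleftrightarrow> (\<forall>i<n. v i = w i)" for n and v w :: "nat \<Rightarrow> 'x"
  have step: "\<exists>w. P w \<and> agree n w v \<and> (\<forall>w'. P w' \<and> agree n w' v \<longrightarrow> size (w n) \<le> size (w' n))"
    if "P v" for v n
    using ex_has_least_nat[of "\<lambda>w. P w \<and> agree n w v" v "\<lambda>w. size (w n)"] that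
    by (auto simp: agree_def)
  obtain B where PB: "\<And>n. P (B n)"
    and B_step: "\<And>n. agree n (B (Suc n)) (B n) \<and>
      (\<forall>w'. P w' \<and> agree n w' (B n) \<longrightarrow> size (B (Suc n) n) \<le> size (w' n))"
    using dependent_nat_choice[of "\<lambda>_. P" "\<lambda>n v w. agree n w v \<and>
      (\<forall>w'. P w' \<and> agree n w' v \<longrightarrow> size (w n) \<le> size (w' n))"] step \<open>P u\<close>
    by metis
  define m where "m n = B (Suc n) n" for n
  have prefix: "agree n (B n) m" for n
  proof (induction n)
    case (Suc n)
    then show ?case
      using B_step[of n] by (auto simp: agree_def m_def less_Suc_eq)
  qed (simp add: agree_def)
  show thesis
  proof
    show "P m"
      using closed[of m] PB prefix unfolding agree_def by blast
  next
    fix n v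
    assume "P v" and "\<And>i. i < n \<Longrightarrow> v i = m i"
    then have "agree n v (B n)"
      using prefix[of n] by (simp add: agree_def)
    then show "size (m n) \<le> size (v n)"
      using B_step[of n] \<open>P v\<close> by (simp add: m_def)
  qed
qed

text \<open>Higman's lemma for the values of words rather than for words. In a minimal bad sequence,
  infinitely many words end in the same letter \<open>a\<close>. Replacing the tail of the sequence, from the
  first of them on, by these words with the final \<open>a\<close> removed gives a bad sequence again:
  a comparison \<open>val x \<le> val y\<close> between two shortened words survives appending \<open>a\<close> to both
  by monotonicity, and one between an old word and a shortened one survives appending \<open>a\<close> to the
  latter because the letters act inflationarily. This contradicts minimality.\<close>

lemma foldl_inflationary_mono_good:
  fixes act :: "'h::order \<Rightarrow> 'a \<Rightarrow> 'h"
  assumes "finite A"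
    and mono: "\<And>x y a. x \<le> y \<Longrightarrow> act x a \<le> act y a"
    and inflationary: "\<And>x a. x \<le> act x a"
    and words: "\<And>i :: nat. set (u i) \<subseteq> A"
  shows "\<exists>i j. i < j \<and> foldl act h (u i) \<le> foldl act h (u j)"
proof (rule ccontr)
  assume not_good: "\<not> ?thesis"
  let ?val = "foldl act h"
  define bad where
    "bad v \<longleftrightarrow> (\<forall>i. set (v i) \<subseteq> A) \<and> (\<forall>i j. i < j \<longrightarrow> \<not> ?val (v i) \<le> ?val (v j))"
    for v :: "nat \<Rightarrow> 'a list"
  have "bad u"
    using not_good words by (simp add: bad_def)
  moreover have "bad m" if prefixes: "\<And>n. \<exists>v. bad v \<and> (\<forall>i<n. v i = m i)" for m
    unfolding bad_def
  proof (intro conjI allI impI)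
    fix i
    show "set (m i) \<subseteq> A"
      using prefixes[of "Suc i"] by (metis bad_def lessI)
  next
    fix i j :: nat
    assume "i < j"
    then show "\<not> ?val (m i) \<le> ?val (m j)"
      using prefixes[of "Suc j"] by (metis bad_def less_SucI lessI)
  qed
  ultimately obtain m where "bad m"
    and minimal: "\<And>n v. bad v \<Longrightarrow> (\<And>i. i < n \<Longrightarrow> v i = m i) \<Longrightarrow> length (m n) \<le> length (v n)"
    using minimal_sequence_exists[of bad u length] by blast
  have m_letters: "set (m i) \<subseteq> A" for i
    using \<open>bad m\<close> by (simp add: bad_def)
  have m_bad: "\<not> ?val (m i) \<le> ?val (m j)" if "i < j" for i j
    using \<open>bad m\<close> that by (simp add: bad_def)
  have val_above: "h \<le> ?val w" for w
  proof (induction w rule: rev_induct)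
    case (snoc a w)
    then show ?case
      using inflationary[of "?val w" a] by simp
  qed simp
  have nonempty: "m i \<noteq> []" for i
    using m_bad[of i "Suc i"] val_above by auto
  have "range (\<lambda>i. last (m i)) \<subseteq> A"
    using nonempty m_letters last_in_set by blast
  then have "finite (range (\<lambda>i. last (m i)))"
    using \<open>finite A\<close> finite_subset by blast
  then obtain k where inf: "infinite {i. last (m i) = last (m k)}"
    using pigeonhole_infinite[of UNIV "\<lambda>i. last (m i)"] by auto
  define a where "a = last (m k)"
  obtain r :: "nat \<Rightarrow> nat" where "strict_mono r" and r: "\<And>i. last (m (r i)) = a"
    using infinite_enumerate[OF inf] by (auto simp: a_def)
  have split: "m (r i) = butlast (m (r i)) @ [a]" for i
    using nonempty r append_butlast_last_id by metis
  have val_split: "?val (m (r i)) = act (?val (butlast (m (r i)))) a" for i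
    using arg_cong[OF split, of ?val] by simp
  (* The subtraction shifts the shortened words so that they start right at position r 0. *)
  define v where "v i = (if i < r 0 then m i else butlast (m (r (i - r 0))))" for i
  have "bad v"
    unfolding bad_def
  proof (intro conjI allI impI)
    fix i
    show "set (v i) \<subseteq> A"
      using m_letters by (auto simp: v_def dest: in_set_butlastD)
  next
    fix i j :: nat
    assume "i < j"
    show "\<not> ?val (v i) \<le> ?val (v j)"
    proof
      assume le: "?val (v i) \<le> ?val (v j)"
      consider "j < r 0" | "i < r 0" "r 0 \<le> j" | "r 0 \<le> i"
        by linarith
      then show False
      proof cases
        case 1
        then show False
          using le m_bad[OF \<open>i < j\<close>] \<open>i < j\<close> by (simp add: v_def)
      next
        case 2
        then have "?val (m i) \<le> ?val (butlast (m (r (j - r 0))))"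
          using le by (simp add: v_def)
        then have "?val (m i) \<le> ?val (m (r (j - r 0)))"
          using inflationary val_split order_trans by metis
        moreover have "i < r (j - r 0)"
          using 2 \<open>strict_mono r\<close> by (metis le0 less_le_trans strict_mono_less_eq)
        ultimately show False
          using m_bad by blast
      next
        case 3
        then have "?val (m (r (i - r 0))) \<le> ?val (m (r (j - r 0)))"
          using le \<open>i < j\<close> mono val_split by (simp add: v_def)
        moreover have "r (i - r 0) < r (j - r 0)"
          using 3 \<open>i < j\<close> \<open>strict_mono r\<close> by (simp add: strict_mono_less)
        ultimately show False
          using m_bad by blast
      qed
    qed
  qed
  then have "length (m (r 0)) \<le> length (v (r 0))"
    by (rule minimal) (simp add: v_def)
  moreover have "length (v (r 0)) < length (m (r 0))"
    using nonempty[of "r 0"] by (simp add: v_def)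
  ultimately show False
    by simp
qed

text \<open>A strictly descending sequence of values would have no term below a later one.\<close>

lemma wf_foldl_values:
  fixes act :: "'h::order \<Rightarrow> 'a \<Rightarrow> 'h"
  assumes "finite A"
    and "\<And>x y a. x \<le> y \<Longrightarrow> act x a \<le> act y a"
    and "\<And>x a. x \<le> act x a"
  shows "wf {(x, y). x < y \<and> x \<in> foldl act h ` lists A \<and> y \<in> foldl act h ` lists A}"
proof -
  let ?R = "{(x, y). x < y \<and> x \<in> foldl act h ` lists A \<and> y \<in> foldl act h ` lists A}"
  have False if chain: "\<forall>i. (f (Suc i), f i) \<in> ?R" for f :: "nat \<Rightarrow> 'h"
  proof -
    have desc: "f (Suc i) < f i" and vals: "f i \<in> foldl act h ` lists A" for i
      using chain by auto
    have "\<forall>i. \<exists>w. set w \<subseteq> A \<and> f i = foldl act h w"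
      using vals by (simp add: image_iff lists_eq_set)
    then have "\<exists>u. \<forall>i. set (u i) \<subseteq> A \<and> f i = foldl act h (u i)"
      by (rule choice)
    then obtain u where "\<And>i. set (u i) \<subseteq> A" and u: "\<And>i. f i = foldl act h (u i)"
      by blast
    from assms this(1) have "\<exists>i j. i < j \<and> foldl act h (u i) \<le> foldl act h (u j)"
      by (rule foldl_inflationary_mono_good)
    then obtain i j where "i < j" and "f i \<le> f j"
      by (auto simp: u)
    have "f j < f i"
      using \<open>i < j\<close>
    proof (induct i j rule: less_Suc_induct)
      case (1 i)
      show ?case by (rule desc)
    next
      case (2 i j k)
      then show ?case by (metis order.strict_trans)
    qed
    then show False
      using \<open>f i \<le> f j\<close> by (simp add: less_le_not_le)
  qed
  then show ?thesis
    unfolding wf_iff_no_infinite_down_chain by (intro notI) (elim exE)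
qed

section \<open>Dominance of fare states\<close>

context conditional_fare_network
begin

lemma fare_update_ticket_mem:
  assumes "fst f \<in> tickets N" and "a \<in> parcs G"
  shows "fst (fare_update N f a) \<in> tickets N"
  using transition_step[OF assms(1) arc_event_mem[OF assms(2)]] ticket.in_arcsD2 assms(1)
  by (cases f) fastforce

lemma path_state_ticket_mem:
  assumes "p \<in> st_paths G s t"
  shows "fst (path_state N p) \<in> tickets N"
proof -
  have "fst (foldl (fare_update N) f as) \<in> tickets N"
    if "fst f \<in> tickets N" and "set as \<subseteq> parcs G" for f as
    using that by (induction as arbitrary: f) (auto simp: fare_update_ticket_mem)
  moreover have "hd p \<in> pverts G" and "set (vwalk_arcs p) \<subseteq> parcs G"
    using assms by (auto simp: st_paths_def vwalk_def)
  ultimately show ?thesis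
    using initial_state_mem[of "hd p"] by (auto simp: path_state_def)
qed

lemma path_state_weight:
  "snd (path_state N p) =
    foldl (\<lambda>h a. h + arc_weight N a) (snd (initial_state N (hd p))) (vwalk_arcs p)"
proof -
  have "snd (foldl (fare_update N) f as) = foldl (\<lambda>h a. h + arc_weight N a) (snd f) as" for f as
    by (induction as arbitrary: f) (auto split: prod.splits)
  then show ?thesis
    by (simp add: path_state_def)
qed

lemma state_le_ticket_reaches:
  assumes "state_le N f1 f2" and "fst f1 \<in> tickets N"
  shows "ticket_reaches N (fst f1) (fst f2)"
  using assms by (cases f1; cases f2) (auto simp: C_N_def)

lemma wf_strict_ticket_order: "wf ((parcs (ticket_graph N))\<^sup>+)"
  using ticket.pair_finite_arcs ticket_graph_acyclic by (intro wf_trancl finite_acyclic_wf)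

lemma finite_path_prices: "finite (path_price N ` st_paths G s t)"
proof (rule finite_subset)
  show "path_price N ` st_paths G s t \<subseteq> ticket_price N ` tickets N"
    using path_state_ticket_mem by (auto simp: path_price_def)
  show "finite (ticket_price N ` tickets N)"
    using ticket.pair_finite_verts by simp
qed

text \<open>Both \<open>C_F\<close> and \<open>C_P\<close> force the dominating ticket to reach the dominated one. So dominance
  either moves strictly backwards in the acyclic ticket graph or keeps the ticket and lowers the
  weight, and a lexicographic product of well-founded relations contains it.\<close>

lemma wf_state_less_on_paths:
  assumes "\<And>h x :: 'h. h \<le> h + x"
  shows "wf {(q, p). q \<in> st_paths G s t \<and> p \<in> st_paths G s t \<and>
    state_less N (path_state N q) (path_state N p)}"
proof -
  let ?act = "\<lambda>h a. h + arc_weight N a"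
  define W where "W = foldl ?act (snd (initial_state N s)) ` lists (parcs G)"
  have weight_mem: "snd (path_state N p) \<in> W" if "p \<in> st_paths G s t" for p
    using that by (auto simp: W_def path_state_weight st_paths_def vwalk_def)
  have "wf {(x, y). x < y \<and> x \<in> W \<and> y \<in> W}"
    unfolding W_def using routing.pair_finite_arcs
    by (rule wf_foldl_values) (auto intro: translate_right_mono assms)
  then have "wf (inv_image ((parcs (ticket_graph N))\<^sup>+ <*lex*> {(x, y). x < y \<and> x \<in> W \<and> y \<in> W})
      (path_state N))"
    by (intro wf_inv_image wf_lex_prod wf_strict_ticket_order)
  then show ?thesis
  proof (rule wf_subset, safe)
    fix q p
    assume q: "q \<in> st_paths G s t" and p: "p \<in> st_paths G s t"
      and less: "state_less N (path_state N q) (path_state N p)"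
    obtain \<tau>1 h1 \<tau>2 h2 where states: "path_state N q = (\<tau>1, h1)" "path_state N p = (\<tau>2, h2)"
      by (metis surj_pair)
    have "ticket_reaches N \<tau>1 \<tau>2"
      using state_le_ticket_reaches[of "(\<tau>1, h1)" "(\<tau>2, h2)"] less path_state_ticket_mem[OF q] states
      unfolding state_less_def by simp
    then have "(\<tau>1, \<tau>2) \<in> (parcs (ticket_graph N))\<^sup>+" if "\<tau>1 \<noteq> \<tau>2"
      using ticket.reachable_neq_reachable1[of \<tau>1 \<tau>2] that by simp
    then show "(q, p) \<in> inv_image
        ((parcs (ticket_graph N))\<^sup>+ <*lex*> {(x, y). x < y \<and> x \<in> W \<and> y \<in> W}) (path_state N)"
      using less weight_mem[OF q] weight_mem[OF p] states
      by (auto simp: state_less_def)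
  qed
qed

end

section \<open>A cheapest state-optimal path\<close>

theorem proposition4p3:
  fixes G :: "'v pair_pre_digraph"
    and N :: "('v, 't, 'h::po_positive_monoid, 's) cfn"
  assumes "conditional_fare_network G N"
    and weights_nondecreasing: "\<And>h x :: 'h. h \<le> h + x"
    and "s \<in> pverts G" and "t \<in> pverts G"
    and "st_paths G s t \<noteq> {}"
  shows "\<exists>p\<in>state_optimal_paths G N s t.
    path_price N p = Min (path_price N ` st_paths G s t)"
proof -
  interpret conditional_fare_network G N
    by fact
  let ?P = "st_paths G s t" and ?c = "path_price N"
  define Q where "Q = {p \<in> ?P. ?c p = Min (?c ` ?P)}"
  have "Min (?c ` ?P) \<in> ?c ` ?P"
    using finite_path_prices \<open>?P \<noteq> {}\<close> by (intro Min_in) auto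
  then obtain p0 where "p0 \<in> Q"
    unfolding Q_def by force
  show ?thesis
  proof (rule wfE_min[OF wf_state_less_on_paths[OF weights_nondecreasing, of s t] \<open>p0 \<in> Q\<close>])
    fix p
    assume "p \<in> Q" and minimal: "\<And>q. (q, p) \<in> {(q, p). q \<in> ?P \<and> p \<in> ?P \<and>
      state_less N (path_state N q) (path_state N p)} \<Longrightarrow> q \<notin> Q"
    then have "p \<in> ?P" and "?c p = Min (?c ` ?P)"
      by (simp_all add: Q_def)
    have "\<not> state_less N (path_state N q) (path_state N p)" if "q \<in> ?P" for q
    proof
      assume less: "state_less N (path_state N q) (path_state N p)"
      then have "ticket_reaches N (fst (path_state N q)) (fst (path_state N p))"
        using state_le_ticket_reaches path_state_ticket_mem[OF that]
        unfolding state_less_def by metis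
      then have "?c q \<le> ?c p"
        unfolding path_price_def by (rule ticket_price_mono)
      moreover have "Min (?c ` ?P) \<le> ?c q"
        using finite_path_prices that by (intro Min_le) auto
      ultimately have "?c q = Min (?c ` ?P)"
        using \<open>?c p = Min (?c ` ?P)\<close> by (metis order_antisym)
      then have "q \<in> Q"
        using that unfolding Q_def by blast
      moreover have "q \<notin> Q"
        using that \<open>p \<in> ?P\<close> less by (intro minimal) blast
      ultimately show False
        by contradiction
    qed
    then have "p \<in> state_optimal_paths G N s t"
      unfolding state_optimal_paths_def using \<open>p \<in> ?P\<close> by blast
    then show ?thesis
      using \<open>?c p = Min (?c ` ?P)\<close> by blast
  qed
qed

end
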